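(* Consider any full-thrust landing trajectory $(r,v,\omega,m)$ on $[0,t_f]$ in the sense of the context, with final mass $m(t_f)>0$. For any final co-state values $p_v(t_f)\in\mathbb{R}$ and $p_\omega(t_f)\in\mathbb{R}$, the final-time stationarity equation $$-\frac{T_{\mathrm m}}{m(t_f)}\sqrt{p_v^2(t_f)+p_\omega^2(t_f)}-p_v(t_f)+p_0=0$$ always leads to a positive numerical factor $p_0$, i.e. the number $p_0$ determined by this equation satisfies $p_0>0$.
   Context: All quantities are dimensionless: lengths are normalized by the radius $R_0$ of the Moon and the gravitational constant $\mu$ of the Moon is normalized, so that $R_0=1$ and $\mu=1$ (the gravitational acceleration $\mu/R_0^2$ at touchdown is $1$). The constants $T_{\mathrm m}>0$ (maximum thrust), $I_{\mathrm{sp}}>0$ (specific impulse) and $g_{\mathrm e}>0$ (Earth's gravitational acceleration at sea level) are given. The state is $(r,v,\omega,m)$: radial distance $r$ from the Moon's center, radial speed $v$, angular velocity $\omega$, mass $m>0$. A full-thrust landing trajectory is a solution on $[0,t_f]$, $t_f>0$, with (absolutely continuous) states $(r,v,\omega,m)$ and a (measurable) thrust steering angle $\psi(t)\in[-\pi/2,\pi/2]$, of $$\dot r=v,\qquad \dot v=\frac{T_{\mathrm m}}{m}\sin\psi-\frac{\mu}{r^2}+r\omega^2,\qquad \dot\omega=-\frac1r\Big(\frac{T_{\mathrm m}}{m}\cos\psi+2v\omega\Big),\qquad \dot m=-\frac{T_{\mathrm m}}{I_{\mathrm{sp}}g_{\mathrm e}},$$ (i.e. the engine thrust ratio is $u\equiv1$,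 as it is for time-optimal landings), satisfying $r(t)\ge R_0$ for all $t\in[0,t_f]$ and the touchdown conditions $r(t_f)=R_0$, $v(t_f)=0$, $\omega(t_f)=0$. The number $p_0$ is the numerical factor multiplying the cost in the time-optimal cost functional $p_0\int_0^{t_f}1\,\mathrm dt$; $p_r,p_v,p_\omega,p_m$ are the co-states of $r,v,\omega,m$. The displayed stationarity equation is the condition that the Hamiltonian $$p_rv+p_v\Big(\frac{uT_{\mathrm m}}{m}\sin\psi-\frac{\mu}{r^2}+r\omega^2\Big)-\frac{p_\omega}{r}\Big(\frac{uT_{\mathrm m}}{m}\cos\psi+2v\omega\Big)-p_m\frac{uT_{\mathrm m}}{I_{\mathrm{sp}}g_{\mathrm e}}+p_0$$ of the time-optimal problem vanishes at $t_f$, after substituting the touchdown conditions, $p_m(t_f)=0$, $u=1$ and the Hamiltonian-minimizing steering angle.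
   Formalization: The final co-state values p_v(t_f) and p_ω(t_f) are assumed not both zero; when both vanish the stationarity equation gives p_0 = 0, so the claim as stated fails in that case. *)

theory Defs
  imports "HOL-Analysis.Analysis"
begin

text \<open>
  Absolute continuity of a function on a compact interval. The library constant
  \<^const>\<open>absolutely_continuous\<close> is a different notion, relating two measures.
\<close>

definition abs_continuous_on :: "real \<Rightarrow> real \<Rightarrow> (real \<Rightarrow> real) \<Rightarrow> bool" where
  "abs_continuous_on \<alpha> \<beta> f \<longleftrightarrow>
     (\<forall>\<epsilon>>0. \<exists>\<delta>>0. \<forall>(I :: nat set) a b.
        finite I \<and> (\<forall>i\<in>I. \<alpha> \<le> a i \<and> a i < b i \<and> b i \<le> \<beta>) \<and>
        disjoint_family_on (\<lambda>i. {a i<..<b i}) I \<and> (\<Sum>i\<in>I. b i - a i) < \<delta> \<longrightarrow>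
        (\<Sum>i\<in>I. \<bar>f (b i) - f (a i)\<bar>) < \<epsilon>)"

text \<open>Normalized units: lunar radius and lunar gravitational constant.\<close>

definition R\<^sub>0 :: real where "R\<^sub>0 = 1"

definition \<mu> :: real where "\<mu> = 1"

text \<open>
  Full-thrust landing trajectories (thrust ratio identically 1), with maximum thrust \<open>T\<^sub>m\<close>,
  specific impulse \<open>I\<^sub>s\<^sub>p\<close>, gravitational acceleration \<open>g\<^sub>e\<close> and steering angle \<open>\<psi>\<close>.
  Since \<open>\<psi>\<close> is merely measurable, solutions are understood in the sense of Caratheodory:
  the states are absolutely continuous and the equations hold for almost every time. Only the
  values on \<open>{0..t\<^sub>f}\<close> matter.
\<close>

definition full_thrust_landing ::
  "real \<Rightarrow> real \<Rightarrow> real \<Rightarrow> real \<Rightarrow> (real \<Rightarrow> real) \<Rightarrow> (real \<Rightarrow> real) \<Rightarrow> (real \<Rightarrow> real) \<Rightarrow>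
     (real \<Rightarrow> real) \<Rightarrow> (real \<Rightarrow> real) \<Rightarrow> bool" where
  "full_thrust_landing T\<^sub>m I\<^sub>s\<^sub>p g\<^sub>e t\<^sub>f r v \<omega> m \<psi> \<longleftrightarrow>
     t\<^sub>f > 0 \<and>
     abs_continuous_on 0 t\<^sub>f r \<and> abs_continuous_on 0 t\<^sub>f v \<and>
     abs_continuous_on 0 t\<^sub>f \<omega> \<and> abs_continuous_on 0 t\<^sub>f m \<and>
     \<psi> \<in> borel_measurable (lebesgue_on {0..t\<^sub>f}) \<and>
     (\<forall>t\<in>{0..t\<^sub>f}. \<psi> t \<in> {-pi/2..pi/2}) \<and>
     (AE t in lebesgue_on {0..t\<^sub>f}.
        (r has_real_derivative v t) (at t within {0..t\<^sub>f}) \<and>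
        (v has_real_derivative
           (T\<^sub>m / m t * sin (\<psi> t) - \<mu> / (r t)\<^sup>2 + r t * (\<omega> t)\<^sup>2)) (at t within {0..t\<^sub>f}) \<and>
        (\<omega> has_real_derivative
           (- (1 / r t) * (T\<^sub>m / m t * cos (\<psi> t) + 2 * v t * \<omega> t))) (at t within {0..t\<^sub>f}) \<and>
        (m has_real_derivative (- T\<^sub>m / (I\<^sub>s\<^sub>p * g\<^sub>e))) (at t within {0..t\<^sub>f})) \<and>
     (\<forall>t\<in>{0..t\<^sub>f}. m t > 0) \<and>
     (\<forall>t\<in>{0..t\<^sub>f}. r t \<ge> R\<^sub>0) \<and>
     r t\<^sub>f = R\<^sub>0 \<and> v t\<^sub>f = 0 \<and> \<omega> t\<^sub>f = 0"

end

theory Submission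
  imports Defs
begin

text \<open>
  The touchdown equation reads \<open>p\<^sub>0 = T\<^sub>m / m t\<^sub>f * P + p\<^sub>v\<close>, where \<open>P\<close> is the Euclidean norm of
  \<open>(p\<^sub>v, p\<^sub>\<omega>)\<close>. Since \<open>p\<^sub>v \<ge> -P\<close>, positivity of \<open>p\<^sub>0\<close> follows once \<open>T\<^sub>m / m t\<^sub>f > 1\<close>, that is, once
  the maximum thrust exceeds the lunar weight of the vehicle at touchdown. The strict inequality
  matters: a co-state \<open>(p\<^sub>v, 0)\<close> with \<open>p\<^sub>v < 0\<close> attains \<open>p\<^sub>v = -P\<close>.

  The inequality is forced by the dynamics (\<open>max_thrust_exceeds_touchdown_weight\<close>). Suppose
  \<open>T\<^sub>m \<le> m t\<^sub>f\<close>, and let \<open>\<tau> = t\<^sub>f - t\<close> be the time to go. Mass is burnt at a constant rate, so shortly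
  before touchdown the thrust acceleration is at most \<open>1 - c * \<tau>\<close> for some \<open>c > 0\<close>. Gravity differs
  from \<open>1\<close> only by \<open>o(\<tau>)\<close>, because the radial speed tends to \<open>0\<close>, and the centrifugal term is
  \<open>O(\<tau>\<^sup>2)\<close>, because the angular velocity vanishes at touchdown and has a bounded derivative. The net
  radial acceleration is therefore negative close to \<open>t\<^sub>f\<close>. As the radial speed ends at \<open>0\<close>, it was
  positive before, so the vehicle was rising and ends strictly above an earlier position. That
  position lay below the surface, contradicting \<open>r \<ge> R\<^sub>0\<close>.

  The equations hold only almost everywhere, so every comparison above rests on one fact: an
  absolutely continuous function whose derivative is at most \<open>K\<close> almost everywhere grows at most at
  rate \<open>K\<close> (\<open>abs_continuous_deriv_le_imp_increment_le\<close>).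
\<close>

section \<open>Absolutely continuous functions\<close>

text \<open>
  The definition indexes families of intervals by natural numbers. Below, the intervals come from
  a tagged division and are naturally indexed by its members.
\<close>

lemma abs_continuous_on_any_index:
  assumes "abs_continuous_on \<alpha> \<beta> f" "\<epsilon> > 0"
  obtains \<delta> where "\<delta> > 0"
    and "\<forall>(I :: 'i set) a b.
        finite I \<and> (\<forall>i\<in>I. \<alpha> \<le> a i \<and> a i < b i \<and> b i \<le> \<beta>) \<and>
        disjoint_family_on (\<lambda>i. {a i<..<b i}) I \<and> (\<Sum>i\<in>I. b i - a i) < \<delta> \<longrightarrow>
        (\<Sum>i\<in>I. \<bar>f (b i) - f (a i)\<bar>) < \<epsilon>"
proof -
  obtain \<delta> where "\<delta> > 0" and \<delta>: "\<forall>(I :: nat set) a b.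
        finite I \<and> (\<forall>i\<in>I. \<alpha> \<le> a i \<and> a i < b i \<and> b i \<le> \<beta>) \<and>
        disjoint_family_on (\<lambda>i. {a i<..<b i}) I \<and> (\<Sum>i\<in>I. b i - a i) < \<delta> \<longrightarrow>
        (\<Sum>i\<in>I. \<bar>f (b i) - f (a i)\<bar>) < \<epsilon>"
    using assms unfolding abs_continuous_on_def by blast
  show thesis
  proof (rule that[OF \<open>\<delta> > 0\<close>], intro allI impI, elim conjE)
    fix I :: "'i set" and a b
    assume *: "finite I" "\<forall>i\<in>I. \<alpha> \<le> a i \<and> a i < b i \<and> b i \<le> \<beta>"
        "disjoint_family_on (\<lambda>i. {a i<..<b i}) I" "(\<Sum>i\<in>I. b i - a i) < \<delta>"
    obtain h where h: "bij_betw h {0..<card I} I"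
      using * ex_bij_betw_nat_finite by blast
    have inj: "inj_on h {0..<card I}" and img: "\<And>k. k \<in> {0..<card I} \<Longrightarrow> h k \<in> I"
      using h by (auto simp: bij_betw_def)
    have "disjoint_family_on (\<lambda>k. {a (h k)<..<b (h k)}) {0..<card I}"
      using *(3) img inj unfolding disjoint_family_on_def inj_on_def by metis
    moreover have "(\<Sum>k\<in>{0..<card I}. b (h k) - a (h k)) < \<delta>"
      using *(4) sum.reindex_bij_betw[OF h, of "\<lambda>i. b i - a i"] by simp
    ultimately have "(\<Sum>k\<in>{0..<card I}. \<bar>f (b (h k)) - f (a (h k))\<bar>) < \<epsilon>"
      using *(2) img
      by (intro \<delta>[THEN spec[of _ "{0..<card I}"], THEN spec[of _ "a \<circ> h"],
            THEN spec[of _ "b \<circ> h"], THEN mp, unfolded comp_def]) auto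
    then show "(\<Sum>i\<in>I. \<bar>f (b i) - f (a i)\<bar>) < \<epsilon>"
      using sum.reindex_bij_betw[OF h, of "\<lambda>i. \<bar>f (b i) - f (a i)\<bar>"] by simp
  qed
qed

lemma abs_continuous_on_imp_continuous_on:
  assumes "abs_continuous_on \<alpha> \<beta> f"
  shows "continuous_on {\<alpha>..\<beta>} f"
  unfolding continuous_on_iff
proof (intro ballI allI impI)
  fix x \<epsilon> :: real
  assume x: "x \<in> {\<alpha>..\<beta>}" and "\<epsilon> > 0"
  obtain \<delta> where "\<delta> > 0" and \<delta>: "\<forall>(I :: unit set) a b.
        finite I \<and> (\<forall>i\<in>I. \<alpha> \<le> a i \<and> a i < b i \<and> b i \<le> \<beta>) \<and>
        disjoint_family_on (\<lambda>i. {a i<..<b i}) I \<and> (\<Sum>i\<in>I. b i - a i) < \<delta> \<longrightarrow>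
        (\<Sum>i\<in>I. \<bar>f (b i) - f (a i)\<bar>) < \<epsilon>"
    using abs_continuous_on_any_index[OF assms \<open>\<epsilon> > 0\<close>] .
  have step: "\<bar>f d - f c\<bar> < \<epsilon>" if "\<alpha> \<le> c" "c < d" "d \<le> \<beta>" "d - c < \<delta>" for c d
    using \<delta>[rule_format, of "{()}" "\<lambda>_. c" "\<lambda>_. d"] that by (simp add: disjoint_family_on_def)
  show "\<exists>d>0. \<forall>y\<in>{\<alpha>..\<beta>}. dist y x < d \<longrightarrow> dist (f y) (f x) < \<epsilon>"
  proof (intro exI[of _ \<delta>] conjI ballI impI \<open>\<delta> > 0\<close>)
    fix y assume y: "y \<in> {\<alpha>..\<beta>}" "dist y x < \<delta>"
    show "dist (f y) (f x) < \<epsilon>"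
      using step[of x y] step[of y x] x y \<open>\<epsilon> > 0\<close>
      by (cases x y rule: linorder_cases) (auto simp: dist_real_def abs_minus_commute)
  qed
qed

section \<open>Increments and almost-everywhere derivative bounds\<close>

lemma negligible_imp_small_open_superset:
  fixes N :: "'a :: euclidean_space set"
  assumes "negligible N" "\<delta> > 0"
  obtains U where "open U" "N \<subseteq> U" "U \<in> lmeasurable" "measure lebesgue U < \<delta>"
proof -
  have N: "N \<in> null_sets lebesgue"
    using assms negligible_iff_null_sets by blast
  then obtain U where U: "open U" "N \<subseteq> U" "U - N \<in> lmeasurable"
      "emeasure lebesgue (U - N) < ennreal \<delta>"
    using sets_lebesgue_outer_open[OF _ \<open>\<delta> > 0\<close>] by blast
  have "emeasure lebesgue U = emeasure lebesgue (U - N)"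
    using N U(1) by (simp add: emeasure_Diff_null_set)
  with U have "emeasure lebesgue U < ennreal \<delta>" by simp
  moreover from this have "U \<in> lmeasurable"
    using U(1) by (intro fmeasurableI) (auto simp: less_top[symmetric] intro: order.strict_trans)
  ultimately show ?thesis
    using that U(1,2) \<open>\<delta> > 0\<close>
    by (metis emeasure_eq_measure2 ennreal_less_iff measure_nonneg)
qed

text \<open>
  Let \<open>N\<close> be the exceptional null set. Choose a gauge that keeps intervals tagged in \<open>N\<close> inside an
  open set of tiny measure, and all other intervals so short that the derivative at the tag
  controls the increment. For a division fine for this gauge, the intervals tagged outside \<open>N\<close>
  contribute at most \<open>K + \<epsilon>\<close> times their length, while those tagged in \<open>N\<close> have tiny total length
  and thus, by absolute continuity, tiny total variation.
\<close>

lemma abs_continuous_deriv_le_imp_increment_le: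
  assumes ac: "abs_continuous_on \<alpha> \<beta> f"
    and sub: "\<alpha> \<le> a" "a \<le> b" "b \<le> \<beta>"
    and N: "negligible N"
    and deriv: "\<And>t. t \<in> {a..b} - N \<Longrightarrow>
      \<exists>D\<le>K. (f has_real_derivative D) (at t within {\<alpha>..\<beta>})"
  shows "f b - f a \<le> K * (b - a)"
proof (rule field_le_epsilon)
  fix e :: real
  assume "e > 0"
  define \<epsilon> where "\<epsilon> = e / (2 + (b - a))"
  have \<epsilon>: "\<epsilon> > 0" "\<epsilon> * (2 + (b - a)) = e"
    using \<open>e > 0\<close> sub by (auto simp: \<epsilon>_def)
  obtain \<delta>0 where "\<delta>0 > 0" and \<delta>0: "\<forall>(I :: (real \<times> real set) set) a b.
        finite I \<and> (\<forall>i\<in>I. \<alpha> \<le> a i \<and> a i < b i \<and> b i \<le> \<beta>) \<and>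
        disjoint_family_on (\<lambda>i. {a i<..<b i}) I \<and> (\<Sum>i\<in>I. b i - a i) < \<delta>0 \<longrightarrow>
        (\<Sum>i\<in>I. \<bar>f (b i) - f (a i)\<bar>) < \<epsilon>"
    using abs_continuous_on_any_index[OF ac \<open>\<epsilon> > 0\<close>] .
  \<comment> \<open>The second bound makes the term \<open>K\<close> times length negligible on the exceptional intervals too;
    it has the wrong sign there when \<open>K\<close> is negative.\<close>
  define \<delta> where "\<delta> = min \<delta>0 (\<epsilon> / (\<bar>K\<bar> + 1))"
  have \<delta>: "\<delta> > 0" "\<delta> \<le> \<delta>0" "\<bar>K\<bar> * \<delta> \<le> \<epsilon>"
  proof -
    show "\<delta> > 0" "\<delta> \<le> \<delta>0" using \<open>\<delta>0 > 0\<close> \<epsilon> by (auto simp: \<delta>_def)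
    have "\<bar>K\<bar> * \<delta> \<le> (\<bar>K\<bar> + 1) * (\<epsilon> / (\<bar>K\<bar> + 1))"
      using \<epsilon> by (intro mult_mono) (auto simp: \<delta>_def \<open>\<delta>0 > 0\<close> less_imp_le)
    also have "\<dots> = \<epsilon>" by simp
    finally show "\<bar>K\<bar> * \<delta> \<le> \<epsilon>" .
  qed
  obtain U where U: "open U" "N \<subseteq> U" "U \<in> lmeasurable" "measure lebesgue U < \<delta>"
    using negligible_imp_small_open_superset[OF N \<open>\<delta> > 0\<close>] .
  have "\<exists>\<rho>>0. (x \<in> N \<longrightarrow> ball x \<rho> \<subseteq> U) \<and>
      (x \<in> {a..b} - N \<longrightarrow> (\<forall>c d. a \<le> c \<and> c \<le> x \<and> x \<le> d \<and> d \<le> b \<and> {c..d} \<subseteq> ball x \<rho> \<longrightarrow>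
          f d - f c \<le> (K + \<epsilon>) * (d - c)))" for x
  proof (cases "x \<in> {a..b} - N")
    case False
    then show ?thesis
      using U open_contains_ball by (metis subsetD zero_less_one)
  next
    case True
    then obtain D where D: "D \<le> K" "(f has_real_derivative D) (at x within {\<alpha>..\<beta>})"
      using deriv by blast
    then obtain \<rho> where \<rho>: "\<rho> > 0"
      "\<And>y. y \<in> {\<alpha>..\<beta>} \<Longrightarrow> \<bar>y - x\<bar> < \<rho> \<Longrightarrow> \<bar>f y - f x - D * (y - x)\<bar> \<le> \<epsilon> * \<bar>y - x\<bar>"
      using \<epsilon>(1) unfolding has_field_derivative_def has_derivative_within_alt real_norm_def by meson
    have "f d - f c \<le> (K + \<epsilon>) * (d - c)"
      if cd: "a \<le> c" "c \<le> x" "x \<le> d" "d \<le> b" "{c..d} \<subseteq> ball x \<rho>" for c d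
    proof -
      have "c \<in> ball x \<rho>" "d \<in> ball x \<rho>"
        using subsetD[OF cd(5), of c] subsetD[OF cd(5), of d] cd(2,3) by auto
      then have "\<bar>f d - f x - D * (d - x)\<bar> \<le> \<epsilon> * (d - x)" "\<bar>f c - f x - D * (c - x)\<bar> \<le> \<epsilon> * (x - c)"
        using \<rho>(2)[of c] \<rho>(2)[of d] cd sub by (auto simp: dist_real_def)
      then have "f d - f c \<le> D * (d - c) + \<epsilon> * (d - c)"
        by (simp add: algebra_simps abs_le_iff)
      also have "\<dots> \<le> (K + \<epsilon>) * (d - c)"
        using mult_right_mono[OF D(1), of "d - c"] cd by (simp add: algebra_simps)
      finally show ?thesis .
    qed
    then show ?thesis using \<rho>(1) True by blast
  qed
  then obtain \<rho> where \<rho>: "\<And>x. \<rho> x > 0" "\<And>x. x \<in> N \<Longrightarrow> ball x (\<rho> x) \<subseteq> U"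
    "\<And>x c d. \<lbrakk>x \<in> {a..b} - N; a \<le> c; c \<le> x; x \<le> d; d \<le> b; {c..d} \<subseteq> ball x (\<rho> x)\<rbrakk>
        \<Longrightarrow> f d - f c \<le> (K + \<epsilon>) * (d - c)"
    by metis
  have "gauge (\<lambda>x. ball x (\<rho> x))"
    using \<rho>(1) by (simp add: gauge_ball_dependent)
  then obtain p where p: "p tagged_division_of {a..b}" "(\<lambda>x. ball x (\<rho> x)) fine p"
    using fine_division_exists_real by blast
  have pcell: "a \<le> Inf L" "Inf L \<le> x" "x \<le> Sup L" "Sup L \<le> b" "{Inf L..Sup L} \<subseteq> ball x (\<rho> x)"
      "{Inf L..Sup L} = L"
    if xL: "(x, L) \<in> p" for x L
  proof -
    obtain c d where L: "L = {c..d}"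
      using tagged_division_ofD(4)[OF p(1) xL] by auto
    have "x \<in> L" "L \<subseteq> {a..b}"
      using tagged_division_ofD(2,3)[OF p(1) xL] .
    moreover have "L \<subseteq> ball x (\<rho> x)"
      using p(2) xL by (auto simp: fine_def)
    ultimately show "a \<le> Inf L" "Inf L \<le> x" "x \<le> Sup L" "Sup L \<le> b" "{Inf L..Sup L} \<subseteq> ball x (\<rho> x)"
      "{Inf L..Sup L} = L"
      by (auto simp: L)
  qed
  \<comment> \<open>A tagged division may contain one-point intervals. They contribute nothing, but absolute
    continuity speaks of proper intervals only.\<close>
  define B where "B = {(x, L) \<in> p. x \<in> N \<and> Inf L < Sup L}"
  have "finite p" using p(1) by blast
  then have "finite B" unfolding B_def by (rule finite_subset[rotated]) auto
  define lo hi where "lo = (\<lambda>i :: real \<times> real set. Inf (snd i))" and "hi = (\<lambda>i :: real \<times> real set. Sup (snd i))"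
  have Bcell: "\<alpha> \<le> lo i \<and> lo i < hi i \<and> hi i \<le> \<beta>" if "i \<in> B" for i
    using that pcell[of "fst i" "snd i"] sub by (auto simp: B_def lo_def hi_def)
  have disj: "disjoint_family_on (\<lambda>i. {lo i<..<hi i}) B"
    unfolding disjoint_family_on_def
  proof (intro ballI impI)
    fix i j assume ij: "i \<in> B" "j \<in> B" "i \<noteq> j"
    have int: "interior (snd k) = {lo k<..<hi k}" if "k \<in> B" for k
    proof -
      have "snd k = {lo k..hi k}"
        using that pcell(6)[of "fst k" "snd k"] by (auto simp: B_def lo_def hi_def)
      then show ?thesis by (simp only: interior_atLeastAtMost_real)
    qed
    have "interior (snd i) \<inter> interior (snd j) = {}"
      using ij by (intro tagged_division_ofD(5)[OF p(1), of "fst i" _ "fst j"]) (auto simp: B_def)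
    then show "{lo i<..<hi i} \<inter> {lo j<..<hi j} = {}"
      using int ij by simp
  qed
  have "(\<Sum>i\<in>B. hi i - lo i) = (\<Sum>i\<in>B. measure lebesgue {lo i<..<hi i})"
    using Bcell by (intro sum.cong) (auto simp: less_imp_le)
  also have "\<dots> = measure lebesgue (\<Union>i\<in>B. {lo i<..<hi i})"
    using disj \<open>finite B\<close> Bcell
    by (intro measure_finite_Union[symmetric]) (auto simp: less_imp_le)
  also have "\<dots> \<le> measure lebesgue U"
  proof (rule measure_mono_fmeasurable[OF _ _ U(3)])
    show "(\<Union>i\<in>B. {lo i<..<hi i}) \<subseteq> U"
    proof (intro UN_least)
      fix i assume "i \<in> B"
      then have "{lo i..hi i} \<subseteq> ball (fst i) (\<rho> (fst i))" "fst i \<in> N"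
        using pcell(5)[of "fst i" "snd i"] by (auto simp: B_def lo_def hi_def)
      then show "{lo i<..<hi i} \<subseteq> U" using \<rho>(2)[of "fst i"] by force
    qed
  qed (use \<open>finite B\<close> in auto)
  finally have len: "(\<Sum>i\<in>B. hi i - lo i) < \<delta>" using U(4) by simp
  then have var: "(\<Sum>i\<in>B. \<bar>f (hi i) - f (lo i)\<bar>) < \<epsilon>"
    using \<delta> Bcell disj \<open>finite B\<close> by (intro \<delta>0[rule_format]) auto
  have "f b - f a = (\<Sum>i\<in>p. f (hi i) - f (lo i))"
    using additive_tagged_division_1[OF \<open>a \<le> b\<close> p(1), of f] by (simp add: lo_def hi_def case_prod_beta)
  also have "\<dots> \<le> (\<Sum>i\<in>p. (K + \<epsilon>) * (hi i - lo i) +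
      (if i \<in> B then \<bar>f (hi i) - f (lo i)\<bar> + \<bar>K\<bar> * (hi i - lo i) else 0))"
  proof (rule sum_mono)
    fix i assume i: "i \<in> p"
    obtain x L where xL: "i = (x, L)" by fastforce
    note c = pcell[OF i[unfolded xL]]
    consider "i \<in> B" | "i \<notin> B" "x \<in> N" | "i \<notin> B" "x \<notin> N" by blast
    then show "f (hi i) - f (lo i) \<le> (K + \<epsilon>) * (hi i - lo i) +
      (if i \<in> B then \<bar>f (hi i) - f (lo i)\<bar> + \<bar>K\<bar> * (hi i - lo i) else 0)"
    proof cases
      case 1
      have "- (K * (hi i - lo i)) \<le> \<bar>K\<bar> * (hi i - lo i)" "0 \<le> \<epsilon> * (hi i - lo i)"
        using Bcell[OF 1] \<epsilon>(1) mult_right_mono[of "-K" "\<bar>K\<bar>" "hi i - lo i"] by auto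
      then show ?thesis using 1 by (simp add: algebra_simps)
    next
      case 2
      then have "Inf L = Sup L" using c i xL by (auto simp: B_def)
      then show ?thesis using 2 by (simp add: xL lo_def hi_def)
    next
      case 3
      then show ?thesis using \<rho>(3)[of x "Inf L" "Sup L"] c by (simp add: xL lo_def hi_def)
    qed
  qed
  also have "\<dots> = (K + \<epsilon>) * (\<Sum>i\<in>p. hi i - lo i) + ((\<Sum>i\<in>B. \<bar>f (hi i) - f (lo i)\<bar>) + \<bar>K\<bar> * (\<Sum>i\<in>B. hi i - lo i))"
  proof -
    have "B \<subseteq> p" by (auto simp: B_def)
    then have "p \<inter> B = B" by auto
    then show ?thesis
      using \<open>finite p\<close> by (simp add: sum.distrib sum_distrib_left sum.If_cases)
  qed
  also have "(\<Sum>i\<in>p. hi i - lo i) = b - a"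
    using additive_tagged_division_1[OF \<open>a \<le> b\<close> p(1), of "\<lambda>x. x"] by (simp add: lo_def hi_def case_prod_beta)
  also have "\<bar>K\<bar> * (\<Sum>i\<in>B. hi i - lo i) \<le> \<epsilon>"
    using mult_left_mono[OF less_imp_le[OF len], of "\<bar>K\<bar>"] \<delta>(3) by simp
  finally show "f b - f a \<le> K * (b - a) + e"
    using var \<epsilon>(2) by (simp add: algebra_simps)
qed

lemma abs_continuous_on_minus:
  "abs_continuous_on \<alpha> \<beta> f \<Longrightarrow> abs_continuous_on \<alpha> \<beta> (\<lambda>t. - f t)"
  unfolding abs_continuous_on_def by (simp add: abs_minus_commute)

lemma abs_continuous_deriv_ge_imp_increment_ge:
  assumes "abs_continuous_on \<alpha> \<beta> f" "\<alpha> \<le> a" "a \<le> b" "b \<le> \<beta>" "negligible N"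
    and deriv: "\<And>t. t \<in> {a..b} - N \<Longrightarrow>
      \<exists>D\<ge>K. (f has_real_derivative D) (at t within {\<alpha>..\<beta>})"
  shows "K * (b - a) \<le> f b - f a"
proof -
  have "\<exists>D\<le>-K. ((\<lambda>t. - f t) has_real_derivative D) (at t within {\<alpha>..\<beta>})" if t: "t \<in> {a..b} - N" for t
  proof -
    obtain D where "K \<le> D" "(f has_real_derivative D) (at t within {\<alpha>..\<beta>})"
      using deriv[OF t] by blast
    then show ?thesis by (intro exI[of _ "-D"]) (auto intro: DERIV_minus)
  qed
  then have "- f b - - f a \<le> - K * (b - a)"
    using assms by (intro abs_continuous_deriv_le_imp_increment_le[OF abs_continuous_on_minus]) auto
  then show ?thesis by simp
qed

section \<open>The approach to touchdown\<close>

text \<open>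
  If the thrust does not exceed the final weight, then on a short final interval \<open>{s..t\<^sub>f}\<close> the
  radial acceleration is at most \<open>- (c / 2) * (t\<^sub>f - t)\<close>. This makes \<open>v\<close> positive on that interval
  and puts \<open>r s\<close> below the surface.
\<close>

lemma max_thrust_exceeds_touchdown_weight:
  assumes pos: "T\<^sub>m > 0" "I\<^sub>s\<^sub>p > 0" "g\<^sub>e > 0"
    and landing: "full_thrust_landing T\<^sub>m I\<^sub>s\<^sub>p g\<^sub>e t\<^sub>f r v \<omega> m \<psi>"
  shows "T\<^sub>m > m t\<^sub>f"
proof (rule ccontr)
  assume "\<not> T\<^sub>m > m t\<^sub>f"
  then have weak: "T\<^sub>m \<le> m t\<^sub>f" by simp
  note L = landing[unfolded full_thrust_landing_def R\<^sub>0_def \<mu>_def]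
  have tf: "t\<^sub>f > 0" and ac: "abs_continuous_on 0 t\<^sub>f r" "abs_continuous_on 0 t\<^sub>f v"
      "abs_continuous_on 0 t\<^sub>f \<omega>" "abs_continuous_on 0 t\<^sub>f m"
    and mpos: "\<And>t. t \<in> {0..t\<^sub>f} \<Longrightarrow> m t > 0" and rge: "\<And>t. t \<in> {0..t\<^sub>f} \<Longrightarrow> r t \<ge> 1"
    and fin: "r t\<^sub>f = 1" "v t\<^sub>f = 0" "\<omega> t\<^sub>f = 0"
    using L by auto
  obtain N where N: "negligible N" and ode: "\<And>t. t \<in> {0..t\<^sub>f} - N \<Longrightarrow>
        (r has_real_derivative v t) (at t within {0..t\<^sub>f})"
      "\<And>t. t \<in> {0..t\<^sub>f} - N \<Longrightarrow> (v has_real_derivative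
           (T\<^sub>m / m t * sin (\<psi> t) - 1 / (r t)\<^sup>2 + r t * (\<omega> t)\<^sup>2)) (at t within {0..t\<^sub>f})"
      "\<And>t. t \<in> {0..t\<^sub>f} - N \<Longrightarrow> (\<omega> has_real_derivative
           (- (1 / r t) * (T\<^sub>m / m t * cos (\<psi> t) + 2 * v t * \<omega> t))) (at t within {0..t\<^sub>f})"
      "\<And>t. t \<in> {0..t\<^sub>f} - N \<Longrightarrow> (m has_real_derivative (- T\<^sub>m / (I\<^sub>s\<^sub>p * g\<^sub>e))) (at t within {0..t\<^sub>f})"
  proof -
    have "AE t in lebesgue. t \<in> {0..t\<^sub>f} \<longrightarrow>
        (r has_real_derivative v t) (at t within {0..t\<^sub>f}) \<and>
        (v has_real_derivative
           (T\<^sub>m / m t * sin (\<psi> t) - 1 / (r t)\<^sup>2 + r t * (\<omega> t)\<^sup>2)) (at t within {0..t\<^sub>f}) \<and>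
        (\<omega> has_real_derivative
           (- (1 / r t) * (T\<^sub>m / m t * cos (\<psi> t) + 2 * v t * \<omega> t))) (at t within {0..t\<^sub>f}) \<and>
        (m has_real_derivative (- T\<^sub>m / (I\<^sub>s\<^sub>p * g\<^sub>e))) (at t within {0..t\<^sub>f})"
      (is "AE t in lebesgue. ?P t")
      using L by (subst (asm) AE_restrict_space_iff) auto
    then obtain N where "N \<in> null_sets lebesgue" "{t. \<not> ?P t} \<subseteq> N"
      unfolding eventually_ae_filter by auto
    then show thesis
      by (intro that[of N]) (auto simp: negligible_iff_null_sets)
  qed

  define k where "k = T\<^sub>m / (I\<^sub>s\<^sub>p * g\<^sub>e)"
  have "k > 0" using pos by (simp add: k_def)
  have mass: "m t \<ge> m t\<^sub>f + k * (t\<^sub>f - t)" if "t \<in> {0..t\<^sub>f}" for t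
  proof -
    have "m t\<^sub>f - m t \<le> - k * (t\<^sub>f - t)"
      using that N ode(4)
      by (intro abs_continuous_deriv_le_imp_increment_le[OF ac(4)]) (auto simp: k_def)
    then show ?thesis by simp
  qed
  have mf: "m t\<^sub>f > 0" using mpos tf by simp
  \<comment> \<open>The constant arises from \<open>m t\<^sub>f / (m t\<^sub>f + k * \<tau>) = 1 - k * \<tau> / (m t\<^sub>f + k * \<tau>)\<close>, bounding
    \<open>\<tau> \<le> 1\<close> in the denominator.\<close>
  define c where "c = k / (m t\<^sub>f + k)"
  have c: "c > 0" "c < 1" using mf \<open>k > 0\<close> by (auto simp: c_def)
  have thrust: "0 \<le> T\<^sub>m / m t \<and> T\<^sub>m / m t \<le> 1 - c * (t\<^sub>f - t)" if "t \<in> {0..t\<^sub>f}" "t\<^sub>f - t \<le> 1" for t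
  proof -
    let ?\<tau> = "t\<^sub>f - t"
    have \<tau>: "0 \<le> ?\<tau>" "?\<tau> \<le> 1" using that by auto
    have "T\<^sub>m / m t \<le> m t\<^sub>f / (m t\<^sub>f + k * ?\<tau>)"
      using weak mass[OF that(1)] mf \<open>k > 0\<close> \<tau> pos
      by (intro frac_le) (auto intro: add_pos_nonneg)
    also have "\<dots> = 1 - k * ?\<tau> / (m t\<^sub>f + k * ?\<tau>)"
    proof -
      have "m t\<^sub>f + k * ?\<tau> > 0" using mf \<open>k > 0\<close> \<tau> by (intro add_pos_nonneg) auto
      then show ?thesis by (simp add: field_simps)
    qed
    also have "\<dots> \<le> 1 - k * ?\<tau> / (m t\<^sub>f + k)"
      using mf \<open>k > 0\<close> \<tau> by (intro diff_left_mono divide_left_mono mult_pos_pos add_pos_nonneg) (auto simp: mult_left_le)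
    finally show ?thesis
      using pos mpos[OF that(1)] by (simp add: c_def less_imp_le)
  qed

  \<comment> \<open>Of the decrease \<open>c * \<tau>\<close>, gravity may use up \<open>2 * \<eta> * \<tau> = c / 4 * \<tau>\<close> and the centrifugal term
    \<open>18 * \<tau>\<^sup>2 \<le> c / 4 * \<tau>\<close>, which is why \<open>\<tau>\<close> is kept below \<open>c / 72\<close>. Half of it remains.\<close>
  define \<eta> where "\<eta> = c / 8"
  have "\<eta> > 0" "\<eta> < 1" using c by (auto simp: \<eta>_def)
  have near: "\<exists>d>0. \<forall>t\<in>{0..t\<^sub>f}. t\<^sub>f - t < d \<longrightarrow> \<bar>g t - g t\<^sub>f\<bar> < \<eta>"
    if ac_g: "abs_continuous_on 0 t\<^sub>f g" for g
  proof -
    have "t\<^sub>f \<in> {0..t\<^sub>f}" using tf by simp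
    then obtain d where "d > 0" "\<forall>t\<in>{0..t\<^sub>f}. dist t t\<^sub>f < d \<longrightarrow> dist (g t) (g t\<^sub>f) < \<eta>"
      using abs_continuous_on_imp_continuous_on[OF ac_g] \<open>\<eta> > 0\<close> unfolding continuous_on_iff by meson
    then show ?thesis by (intro exI[of _ d]) (auto simp: dist_real_def)
  qed
  obtain d1 where d1: "d1 > 0" "\<And>t. t \<in> {0..t\<^sub>f} \<Longrightarrow> t\<^sub>f - t < d1 \<Longrightarrow> \<bar>r t - 1\<bar> < \<eta>"
    using near[OF ac(1)] fin by auto
  obtain d2 where d2: "d2 > 0" "\<And>t. t \<in> {0..t\<^sub>f} \<Longrightarrow> t\<^sub>f - t < d2 \<Longrightarrow> \<bar>v t\<bar> < \<eta>"
    using near[OF ac(2)] fin by auto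
  obtain d3 where d3: "d3 > 0" "\<And>t. t \<in> {0..t\<^sub>f} \<Longrightarrow> t\<^sub>f - t < d3 \<Longrightarrow> \<bar>\<omega> t\<bar> < \<eta>"
    using near[OF ac(3)] fin by auto
  define d where "d = min (min (min d1 d2) d3) (min t\<^sub>f (c / 72)) / 2"
  have d: "d > 0" "d < d1" "d < d2" "d < d3" "d < t\<^sub>f" "d < c / 72" "d < 1"
    using d1(1) d2(1) d3(1) tf c by (auto simp: d_def)
  define s where "s = t\<^sub>f - d"
  have s: "0 < s" "s < t\<^sub>f" using d by (auto simp: s_def)
  have small: "t \<in> {0..t\<^sub>f}" "t\<^sub>f - t \<le> d" "\<bar>r t - 1\<bar> < \<eta>" "\<bar>v t\<bar> < \<eta>" "\<bar>\<omega> t\<bar> < \<eta>" if "t \<in> {s..t\<^sub>f}" for t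
    using that s d d1(2)[of t] d2(2)[of t] d3(2)[of t] by (auto simp: s_def)

  have altitude: "r t - 1 \<le> \<eta> * (t\<^sub>f - t)" if t: "t \<in> {s..t\<^sub>f}" for t
  proof -
    have "- \<eta> * (t\<^sub>f - t) \<le> r t\<^sub>f - r t"
    proof (rule abs_continuous_deriv_ge_imp_increment_ge[OF ac(1) _ _ _ N])
      fix x assume x: "x \<in> {t..t\<^sub>f} - N"
      then show "\<exists>D\<ge>-\<eta>. (r has_real_derivative D) (at x within {0..t\<^sub>f})"
        using small[of x] t ode(1)[of x] by (intro exI[of _ "v x"]) auto
    qed (use t s in auto)
    then show ?thesis using fin by simp
  qed

  have spin: "\<bar>\<omega> t\<bar> \<le> 3 * (t\<^sub>f - t)" if t: "t \<in> {s..t\<^sub>f}" for t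
  proof -
    have bound: "\<exists>D. \<bar>D\<bar> \<le> 3 \<and> (\<omega> has_real_derivative D) (at x within {0..t\<^sub>f})"
      if x: "x \<in> {t..t\<^sub>f} - N" for x
    proof (intro exI conjI)
      have xs: "x \<in> {s..t\<^sub>f}" using x t by auto
      note sm = small[OF xs]
      show "(\<omega> has_real_derivative
           (- (1 / r x) * (T\<^sub>m / m x * cos (\<psi> x) + 2 * v x * \<omega> x))) (at x within {0..t\<^sub>f})"
        using ode(3) sm x by auto
      have th: "0 \<le> T\<^sub>m / m x" "T\<^sub>m / m x \<le> 1"
        using thrust[of x] sm(1,2) d(7) c(1) mult_nonneg_nonneg[of c "t\<^sub>f - x"]
        by (auto simp del: mult_nonneg_nonneg mult_eq_0_iff zero_le_mult_iff)
      have "\<bar>T\<^sub>m / m x * cos (\<psi> x)\<bar> \<le> 1 * 1"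
        unfolding abs_mult using th by (intro mult_mono) auto
      moreover have "\<bar>v x * \<omega> x\<bar> \<le> 1 * 1"
        unfolding abs_mult using sm \<open>\<eta> < 1\<close> by (intro mult_mono) auto
      ultimately have "\<bar>T\<^sub>m / m x * cos (\<psi> x) + 2 * v x * \<omega> x\<bar> \<le> 3" by linarith
      moreover have "\<bar>- (1 / r x)\<bar> \<le> 1" using rge[OF sm(1)] by simp
      ultimately have "\<bar>- (1 / r x)\<bar> * \<bar>T\<^sub>m / m x * cos (\<psi> x) + 2 * v x * \<omega> x\<bar> \<le> 1 * 3"
        by (intro mult_mono) auto
      then show "\<bar>- (1 / r x) * (T\<^sub>m / m x * cos (\<psi> x) + 2 * v x * \<omega> x)\<bar> \<le> 3"
        unfolding abs_mult by simp
    qed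
    have "\<exists>D\<le>3. (\<omega> has_real_derivative D) (at x within {0..t\<^sub>f})"
      and "\<exists>D\<ge>-3. (\<omega> has_real_derivative D) (at x within {0..t\<^sub>f})"
      if x: "x \<in> {t..t\<^sub>f} - N" for x
      using bound[OF x] unfolding abs_le_iff minus_le_iff[of _ 3] by blast+
    note rates = this
    have "\<omega> t\<^sub>f - \<omega> t \<le> 3 * (t\<^sub>f - t)"
      using t s by (intro abs_continuous_deriv_le_imp_increment_le[OF ac(3) _ _ _ N rates(1)]) auto
    moreover have "- 3 * (t\<^sub>f - t) \<le> \<omega> t\<^sub>f - \<omega> t"
      using t s by (intro abs_continuous_deriv_ge_imp_increment_ge[OF ac(3) _ _ _ N rates(2)]) auto
    ultimately show ?thesis using fin by simp
  qed

  have accel: "T\<^sub>m / m t * sin (\<psi> t) - 1 / (r t)\<^sup>2 + r t * (\<omega> t)\<^sup>2 \<le> - (c / 2) * (t\<^sub>f - t)"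
    if t: "t \<in> {s..t\<^sub>f}" for t
  proof -
    let ?\<tau> = "t\<^sub>f - t"
    note sm = small[OF t]
    have \<tau>: "0 \<le> ?\<tau>" using t by simp
    have r1: "r t \<ge> 1" using rge sm by simp
    have "T\<^sub>m / m t * sin (\<psi> t) \<le> T\<^sub>m / m t * 1"
      using thrust[OF sm(1)] sm d by (intro mult_left_mono) auto
    also have "\<dots> \<le> 1 - c * ?\<tau>" using thrust[OF sm(1)] sm d by auto
    finally have a: "T\<^sub>m / m t * sin (\<psi> t) \<le> 1 - c * ?\<tau>" .
    \<comment> \<open>The tangent line at \<open>1\<close> lies below the convex function \<open>1 / r\<^sup>2\<close>.\<close>
    have "1 - 2 * (r t - 1) \<le> 1 / (r t)\<^sup>2"
    proof -
      have "0 \<le> (r t - 1)\<^sup>2 * (2 * r t + 1)" using r1 by simp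
      then have "(1 - 2 * (r t - 1)) * (r t)\<^sup>2 \<le> 1"
        by (simp add: algebra_simps power2_eq_square)
      then show ?thesis using r1 by (simp add: field_simps)
    qed
    then have b: "1 / (r t)\<^sup>2 \<ge> 1 - 2 * \<eta> * ?\<tau>" using altitude[OF t] by simp
    have "(\<omega> t)\<^sup>2 \<le> (3 * ?\<tau>)\<^sup>2"
      using spin[OF t] by (metis abs_ge_zero power2_abs power_mono)
    then have "r t * (\<omega> t)\<^sup>2 \<le> 2 * (3 * ?\<tau>)\<^sup>2"
      using sm \<open>\<eta> < 1\<close> r1 by (intro mult_mono) auto
    also have "\<dots> = 18 * ?\<tau> * ?\<tau>" by (simp add: power2_eq_square algebra_simps)
    also have "\<dots> \<le> c / 4 * ?\<tau>"
      using sm d \<tau> by (intro mult_right_mono) auto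
    finally have "r t * (\<omega> t)\<^sup>2 \<le> (c * ?\<tau>) / 4" by simp
    moreover have "1 / (r t)\<^sup>2 \<ge> 1 - (c * ?\<tau>) / 4" using b by (simp add: \<eta>_def)
    moreover have "- (c / 2) * ?\<tau> = - (c * ?\<tau>) / 2" by simp
    ultimately show ?thesis using a by linarith
  qed

  have v_decr: "v y - v x \<le> - (c / 2) * (t\<^sub>f - y) * (y - x)" if xy: "s \<le> x" "x \<le> y" "y \<le> t\<^sub>f" for x y
  proof (rule abs_continuous_deriv_le_imp_increment_le[OF ac(2) _ _ _ N])
    fix t assume t: "t \<in> {x..y} - N"
    then have ts: "t \<in> {s..t\<^sub>f}" using xy by auto
    have "- (c / 2) * (t\<^sub>f - t) \<le> - (c / 2) * (t\<^sub>f - y)"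
      using c t by (intro mult_left_mono_neg) auto
    then have "T\<^sub>m / m t * sin (\<psi> t) - 1 / (r t)\<^sup>2 + r t * (\<omega> t)\<^sup>2 \<le> - (c / 2) * (t\<^sub>f - y)"
      using accel[OF ts] by linarith
    moreover have "t \<in> {0..t\<^sub>f} - N" using small(1)[OF ts] t by simp
    ultimately show "\<exists>D\<le>- (c / 2) * (t\<^sub>f - y). (v has_real_derivative D) (at t within {0..t\<^sub>f})"
      using ode(2) by blast
  qed (use xy s in auto)
  have v_nonneg: "v t \<ge> 0" if "t \<in> {s..t\<^sub>f}" for t
    using v_decr[of t t\<^sub>f] that fin by simp

  \<comment> \<open>The bound on the acceleration degenerates at \<open>t\<^sub>f\<close>, so the strict decrease of \<open>v\<close> is read off
    on \<open>{x..y}\<close> with \<open>y < t\<^sub>f\<close>. On \<open>{s..x}\<close> the speed is then at least \<open>v0 > 0\<close>.\<close>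
  define y where "y = (s + t\<^sub>f) / 2"
  define x where "x = (s + y) / 2"
  have xy: "s < x" "x < y" "y < t\<^sub>f" using s by (auto simp: x_def y_def)
  define v0 where "v0 = c / 2 * (t\<^sub>f - y) * (y - x)"
  have "v0 > 0" using xy c by (simp add: v0_def)
  have v_pos: "v t \<ge> v0" if t: "t \<in> {s..x}" for t
  proof -
    have "v t \<ge> v x"
    proof -
      have "- (c / 2) * (t\<^sub>f - x) * (x - t) \<le> 0"
        using c xy t by (auto simp: mult_nonneg_nonneg)
      then show ?thesis using v_decr[of t x] t xy by auto
    qed
    then show ?thesis using v_decr[of x y] xy v_nonneg[of y] by (simp add: v0_def)
  qed
  have "v0 * (x - s) \<le> r x - r s"
  proof (rule abs_continuous_deriv_ge_imp_increment_ge[OF ac(1) _ _ _ N])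
    fix t assume "t \<in> {s..x} - N"
    then show "\<exists>D\<ge>v0. (r has_real_derivative D) (at t within {0..t\<^sub>f})"
      using v_pos[of t] ode(1)[of t] s xy by (intro exI[of _ "v t"]) auto
  qed (use s xy in auto)
  moreover have "0 * (t\<^sub>f - x) \<le> r t\<^sub>f - r x"
  proof (rule abs_continuous_deriv_ge_imp_increment_ge[OF ac(1) _ _ _ N])
    fix t assume "t \<in> {x..t\<^sub>f} - N"
    then show "\<exists>D\<ge>0. (r has_real_derivative D) (at t within {0..t\<^sub>f})"
      using v_nonneg[of t] ode(1)[of t] s xy by (intro exI[of _ "v t"]) auto
  qed (use s xy in auto)
  moreover have "v0 * (x - s) > 0" using \<open>v0 > 0\<close> xy by simp
  ultimately have "r s < 1" using fin by simp
  with rge[of s] s show False by simp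
qed

section \<open>Positivity of the cost factor\<close>

theorem proposition1:
  fixes T\<^sub>m I\<^sub>s\<^sub>p g\<^sub>e t\<^sub>f :: real
    and r v \<omega> m \<psi> :: "real \<Rightarrow> real"
    and p\<^sub>v p\<^sub>\<omega> p\<^sub>0 :: real
  assumes "T\<^sub>m > 0" and "I\<^sub>s\<^sub>p > 0" and "g\<^sub>e > 0"
    and "full_thrust_landing T\<^sub>m I\<^sub>s\<^sub>p g\<^sub>e t\<^sub>f r v \<omega> m \<psi>"
    and "m t\<^sub>f > 0"
    and "(p\<^sub>v, p\<^sub>\<omega>) \<noteq> (0, 0)"
    and "- (T\<^sub>m / m t\<^sub>f) * sqrt (p\<^sub>v\<^sup>2 + p\<^sub>\<omega>\<^sup>2) - p\<^sub>v + p\<^sub>0 = 0"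
  shows "p\<^sub>0 > 0"
proof -
  let ?P = "sqrt (p\<^sub>v\<^sup>2 + p\<^sub>\<omega>\<^sup>2)"
  have "T\<^sub>m / m t\<^sub>f > 1"
    using max_thrust_exceeds_touchdown_weight[OF assms(1-4)] assms(5) by simp
  moreover have "?P > 0"
    using assms(6) by (simp add: sum_power2_gt_zero_iff)
  ultimately have "1 * ?P < T\<^sub>m / m t\<^sub>f * ?P"
    by (intro mult_strict_right_mono)
  moreover have "- p\<^sub>v \<le> ?P"
    by (rule real_le_rsqrt) simp
  ultimately show ?thesis using assms(7) by simp
qed

end
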